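(* Let $f:(\mathbb{R}^2,0)\to(\mathbb{R}^3,0)$ be a frontal with unit normal $\nu$, let $0$ be a singular point of the second kind of $f$, and let $\{\boldsymbol e,\boldsymbol b,\boldsymbol\nu\}$ be the Darboux frame along the singular curve of $f$, defined on a small open interval $I\ni0$, with invariants $\tilde\kappa_g,\tilde\kappa_\nu,\tilde\kappa_t$. (A) Suppose that $\tilde\kappa_t^2+\tilde\kappa_\nu^2\neq0$ and $\tilde\delta_o\neq0$ for any $u\in I$. Then the following are equivalent: (1) $OD_f$ is a cone; (2) $\tilde\sigma_o\equiv0$; (3) $S(f)$ is a tangential contour edge with respect to a central projection; (4) $\boldsymbol s_o$ is a constant vector. (B) Suppose that $\tilde\kappa_t^2+\tilde\kappa_g^2\neq0$ and $\tilde\delta_n\neq0$ for any $u\in I$. Then the following are equivalent: (1) $ND_f$ is a cone; (2) $\tilde\sigma_n\equiv0$; (3) $S(f)$ is a normal contour edge with respect to a central projection; (4) $\boldsymbol s_n$ is a constant vector.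
   Context: All maps are $C^\infty$. A map-germ $f:(\mathbb{R}^2,0)\to(\mathbb{R}^3,0)$ is a frontal if there is a unit vector field $\nu:(\mathbb{R}^2,0)\to S^2$ along $f$ (a unit normal) with $\langle df(X),\nu\rangle=0$ for every tangent vector $X$. $S(f)$ is the set of singular points (points where $f$ is not an immersion). Put $\lambda=\det(f_u,f_v,\nu)$. A singular point $p$ is non-degenerate if $d\lambda(p)\neq0$; then $S(f)$ is a regular curve near $p$, parameterized by $\gamma$, and there is a non-vanishing vector field $\eta$ along $\gamma$ with $\ker df_{\gamma(t)}=\mathbb{R}\,\eta(t)$. With $\phi(t)=\det(\gamma'(t),\eta(t))$, a non-degenerate singular point $0=\gamma(0)$ is of the second kind if $\phi(0)=0$, $\phi'(0)\neq0$. In that case $\hat\gamma=f\circ\gamma$ satisfies $\hat\gamma'(0)=0$ and $\det(\hat\gamma''(0),\hat\gamma'''(0),\nu(0))\ne0$. Coordinates $(u,v)$ are taken with $S(f)=\{v=0\}$, $\gamma(u)=(u,0)$, $\hat\gamma(u)=f(u,0)$ ($u\in I$), and oriented so that $\det(\hat\gamma''(0),\hat\gamma'''(0),\nu(0))>0$; $'=d/du$. Darboux frame: $\boldsymbol e(u)$ is the smooth unit vector field along $\gamma$ that is tangent to $\hat\gamma$ for $u\neq0$ and satisfies $\boldsymbol e(0)=\lim_{u\to+0}\hat\gamma'(u)/|\hat\gamma'(u)|$; $\boldsymbol\nu(u)=\nu(u,0)$; $\boldsymbol b=-\boldsymbol e\times\boldsymbol\nu$. The invariants are defined by $\boldsymbol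 e'=\tilde\kappa_g\boldsymbol b+\tilde\kappa_\nu\boldsymbol\nu$, $\boldsymbol b'=-\tilde\kappa_g\boldsymbol e+\tilde\kappa_t\boldsymbol\nu$, $\boldsymbol\nu'=-\tilde\kappa_\nu\boldsymbol e-\tilde\kappa_t\boldsymbol b$. Let $\varepsilon(u)=\operatorname{sgn}(u)|\hat\gamma'(u)|$, a smooth function with $\hat\gamma'=\varepsilon\boldsymbol e$, $\varepsilon(0)=0$, $\varepsilon'(0)>0$. Osculating and normal developable surfaces ($(u,t)\in I\times\mathbb{R}$): $$OD_f(u,t)=f(u,0)+t\,\overline{D_o}(u),\quad \overline{D_o}=\frac{\tilde\kappa_t\boldsymbol e-\tilde\kappa_\nu\boldsymbol b}{\sqrt{\tilde\kappa_t^2+\tilde\kappa_\nu^2}},\qquad ND_f(u,t)=f(u,0)+t\,\overline{D_n}(u),\quad \overline{D_n}=\frac{\tilde\kappa_t\boldsymbol e+\tilde\kappa_g\boldsymbol\nu}{\sqrt{\tilde\kappa_t^2+\tilde\kappa_g^2}}.$$ Further, $$\tilde\delta_o=\tilde\kappa_g(\tilde\kappa_\nu^2+\tilde\kappa_t^2)-\tilde\kappa_t\tilde\kappa_\nu'+\tilde\kappa_t'\tilde\kappa_\nu,\qquad \tilde\delta_n=\tilde\kappa_\nu(\tilde\kappa_g^2+\tilde\kappa_t^2)-\tilde\kappa_g\tilde\kappa_t'+\tilde\kappa_t\tilde\kappa_g',$$ $$\tilde\sigma_o=-\varepsilon\tilde\kappa_\nu\tilde\delta_o'-(-\varepsilon'\tilde\kappa_\nu+\varepsilon\tilde\kappa_g\tilde\kappa_t-2\varepsilon\tilde\kappa_\nu')\tilde\delta_o,\qquad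 \tilde\sigma_n=-\varepsilon\tilde\kappa_g\tilde\delta_n'+(\varepsilon'\tilde\kappa_g+\varepsilon\tilde\kappa_\nu\tilde\kappa_t+2\varepsilon\tilde\kappa_g')\tilde\delta_n.$$ The striction curves are $\boldsymbol s_o(u)=OD_f(u,t_o(u))$ and $\boldsymbol s_n(u)=ND_f(u,t_n(u))$ with $$t_o=-\frac{\tilde\kappa_\nu\,\varepsilon\,(\tilde\kappa_\nu^2+\tilde\kappa_t^2)^{1/2}}{\tilde\delta_o},\qquad t_n=\frac{\tilde\kappa_g\,\varepsilon\,(\tilde\kappa_g^2+\tilde\kappa_t^2)^{1/2}}{\tilde\delta_n}.$$ A ruled surface is a cone if all its rulings (the lines $u=\text{const}$) pass through a common point. For a point $\boldsymbol c\in\mathbb{R}^3$, $S(f)$ is the tangential (respectively, normal) contour edge of the central projection with the center $\boldsymbol c$ if $S(f)=\{(u,0)\mid\langle f(u,0)-\boldsymbol c,\boldsymbol\nu(u)\rangle=0\}$ (respectively, $S(f)=\{(u,0)\mid\langle f(u,0)-\boldsymbol c,\boldsymbol b(u)\rangle=0\}$), i.e. the equation holds for all $u\in I$. "With respect to a central projection" means: for some $\boldsymbol c\in\mathbb{R}^3$. *)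

theory Defs
  imports "HOL-Analysis.Analysis"
begin

text \<open>Intended for open \<open>S\<close> and finite-dimensional domains. Differentiability of order \<open>k + 1\<close> is
  expressed through the directional derivatives in all directions \<open>v\<close>.\<close>

primrec k_times_cont_diff_on ::
    "nat \<Rightarrow> 'a set \<Rightarrow> ('a::euclidean_space \<Rightarrow> 'b::real_normed_vector) \<Rightarrow> bool" where
  "k_times_cont_diff_on 0 S f \<longleftrightarrow> continuous_on S f"
| "k_times_cont_diff_on (Suc k) S f \<longleftrightarrow>
     (\<forall>x\<in>S. f differentiable (at x)) \<and>
     (\<forall>v. k_times_cont_diff_on k S (\<lambda>x. frechet_derivative f (at x) v))"

definition smooth_on ::
    "'a set \<Rightarrow> ('a::euclidean_space \<Rightarrow> 'b::real_normed_vector) \<Rightarrow> bool" where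
  "smooth_on S f \<longleftrightarrow> (\<forall>k. k_times_cont_diff_on k S f)"

abbreviation vderiv :: "(real \<Rightarrow> 'a::real_normed_vector) \<Rightarrow> real \<Rightarrow> 'a" where
  "vderiv c \<equiv> \<lambda>t. vector_derivative c (at t)"

text \<open>A germ at \<open>0\<close> is given by a representative \<open>f\<close> on an open neighbourhood \<open>U\<close> of \<open>0\<close>;
  values outside \<open>U\<close> are irrelevant.\<close>

definition frontal_with_normal ::
    "(real^2) set \<Rightarrow> (real^2 \<Rightarrow> real^3) \<Rightarrow> (real^2 \<Rightarrow> real^3) \<Rightarrow> bool" where
  "frontal_with_normal U f \<nu> \<longleftrightarrow>
     open U \<and> 0 \<in> U \<and> smooth_on U f \<and> f 0 = 0 \<and>
     smooth_on U \<nu> \<and>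
     (\<forall>p\<in>U. norm (\<nu> p) = 1 \<and> (\<forall>X. frechet_derivative f (at p) X \<bullet> \<nu> p = 0))"

definition singular_set :: "(real^2) set \<Rightarrow> (real^2 \<Rightarrow> real^3) \<Rightarrow> (real^2) set" where
  "singular_set U f = {p \<in> U. \<not> inj (frechet_derivative f (at p))}"

definition area_density :: "(real^2 \<Rightarrow> real^3) \<Rightarrow> (real^2 \<Rightarrow> real^3) \<Rightarrow> real^2 \<Rightarrow> real" where
  "area_density f \<nu> p =
     det (vector [frechet_derivative f (at p) (axis 1 1),
                  frechet_derivative f (at p) (axis 2 1), \<nu> p] :: real^3^3)"

definition nondegenerate_singular ::
    "(real^2) set \<Rightarrow> (real^2 \<Rightarrow> real^3) \<Rightarrow> (real^2 \<Rightarrow> real^3) \<Rightarrow> real^2 \<Rightarrow> bool" where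
  "nondegenerate_singular U f \<nu> p \<longleftrightarrow>
     p \<in> singular_set U f \<and> frechet_derivative (area_density f \<nu>) (at p) \<noteq> (\<lambda>_. 0)"

text \<open>Here \<open>\<gamma>\<close> is a regular parametrization, with \<open>\<gamma> 0 = p\<close>, of the part of the singular set in a
  neighbourhood \<open>W\<close> of \<open>p\<close>, and \<open>\<eta>\<close> is a null vector field along \<open>\<gamma>\<close>. The last line does not
  depend on the choice of \<open>\<gamma>\<close> and \<open>\<eta>\<close>.\<close>

definition second_kind_singular ::
    "(real^2) set \<Rightarrow> (real^2 \<Rightarrow> real^3) \<Rightarrow> (real^2 \<Rightarrow> real^3) \<Rightarrow> real^2 \<Rightarrow> bool" where
  "second_kind_singular U f \<nu> p \<longleftrightarrow>
     nondegenerate_singular U f \<nu> p \<and>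
     (\<exists>J W (\<gamma> :: real \<Rightarrow> real^2) (\<eta> :: real \<Rightarrow> real^2).
        open J \<and> is_interval J \<and> 0 \<in> J \<and> open W \<and>
        smooth_on J \<gamma> \<and> inj_on \<gamma> J \<and> (\<forall>t\<in>J. vderiv \<gamma> t \<noteq> 0) \<and>
        \<gamma> 0 = p \<and> \<gamma> ` J = singular_set U f \<inter> W \<and>
        smooth_on J \<eta> \<and>
        (\<forall>t\<in>J. \<eta> t \<noteq> 0 \<and> {X. frechet_derivative f (at (\<gamma> t)) X = 0} = span {\<eta> t}) \<and>
        (let \<phi> = (\<lambda>t. det (vector [vderiv \<gamma> t, \<eta> t] :: real^2^2))
         in \<phi> 0 = 0 \<and> deriv \<phi> 0 \<noteq> 0))"

definition u_axis :: "real \<Rightarrow> real^2" where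
  "u_axis u = vector [u, 0]"

definition sing_image :: "(real^2 \<Rightarrow> real^3) \<Rightarrow> real \<Rightarrow> real^3" where
  "sing_image f u = f (u_axis u)"

text \<open>The first line says that \<open>I\<close> is the whole part of the \<open>u\<close>-axis lying in \<open>U\<close>, which can always be
  achieved by shrinking \<open>U\<close>; the second one that \<open>S(f) = {v = 0}\<close>.\<close>

definition adapted_coordinates ::
    "(real^2) set \<Rightarrow> real set \<Rightarrow> (real^2 \<Rightarrow> real^3) \<Rightarrow> (real^2 \<Rightarrow> real^3) \<Rightarrow> bool" where
  "adapted_coordinates U I f \<nu> \<longleftrightarrow>
     open I \<and> is_interval I \<and> 0 \<in> I \<and> {p \<in> U. p $ 2 = 0} = u_axis ` I \<and>
     singular_set U f = {p \<in> U. p $ 2 = 0} \<and>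
     det (vector [(vderiv ^^ 2) (sing_image f) 0, (vderiv ^^ 3) (sing_image f) 0, \<nu> 0]
            :: real^3^3) > 0"

text \<open>Since \<open>e\<close> has unit length, the tangency condition forces \<open>sing_image f\<close> to be regular on
  \<open>I - {0}\<close>.\<close>

definition darboux_tangent :: "real set \<Rightarrow> (real^2 \<Rightarrow> real^3) \<Rightarrow> (real \<Rightarrow> real^3) \<Rightarrow> bool" where
  "darboux_tangent I f e \<longleftrightarrow>
     smooth_on I e \<and> (\<forall>u\<in>I. norm (e u) = 1) \<and>
     (\<forall>u\<in>I - {0}. e u \<in> span {vderiv (sing_image f) u}) \<and>
     ((\<lambda>u. vderiv (sing_image f) u /\<^sub>R norm (vderiv (sing_image f) u)) \<longlongrightarrow> e 0) (at_right 0)"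

definition darboux_normal :: "(real^2 \<Rightarrow> real^3) \<Rightarrow> real \<Rightarrow> real^3" where
  "darboux_normal \<nu> u = \<nu> (u_axis u)"

definition darboux_conormal ::
    "(real^2 \<Rightarrow> real^3) \<Rightarrow> (real \<Rightarrow> real^3) \<Rightarrow> real \<Rightarrow> real^3" where
  "darboux_conormal \<nu> e u = - cross3 (e u) (darboux_normal \<nu> u)"

definition frame_invariants ::
    "real set \<Rightarrow> (real \<Rightarrow> real^3) \<Rightarrow> (real \<Rightarrow> real^3) \<Rightarrow> (real \<Rightarrow> real^3) \<Rightarrow>
     (real \<Rightarrow> real) \<Rightarrow> (real \<Rightarrow> real) \<Rightarrow> (real \<Rightarrow> real) \<Rightarrow> bool" where
  "frame_invariants I e b n \<kappa>g \<kappa>\<nu> \<kappa>t \<longleftrightarrow>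
     (\<forall>u\<in>I. (e has_vector_derivative (\<kappa>g u *\<^sub>R b u + \<kappa>\<nu> u *\<^sub>R n u)) (at u) \<and>
            (b has_vector_derivative (- \<kappa>g u *\<^sub>R e u + \<kappa>t u *\<^sub>R n u)) (at u) \<and>
            (n has_vector_derivative (- \<kappa>\<nu> u *\<^sub>R e u - \<kappa>t u *\<^sub>R b u)) (at u))"

definition signed_speed :: "(real^2 \<Rightarrow> real^3) \<Rightarrow> real \<Rightarrow> real" where
  "signed_speed f u = sgn u * norm (vderiv (sing_image f) u)"

definition osc_direction ::
    "(real \<Rightarrow> real^3) \<Rightarrow> (real \<Rightarrow> real^3) \<Rightarrow> (real \<Rightarrow> real) \<Rightarrow> (real \<Rightarrow> real) \<Rightarrow> real \<Rightarrow> real^3" where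
  "osc_direction e b \<kappa>\<nu> \<kappa>t u =
     (\<kappa>t u *\<^sub>R e u - \<kappa>\<nu> u *\<^sub>R b u) /\<^sub>R sqrt ((\<kappa>t u)\<^sup>2 + (\<kappa>\<nu> u)\<^sup>2)"

definition normal_direction ::
    "(real \<Rightarrow> real^3) \<Rightarrow> (real \<Rightarrow> real^3) \<Rightarrow> (real \<Rightarrow> real) \<Rightarrow> (real \<Rightarrow> real) \<Rightarrow> real \<Rightarrow> real^3" where
  "normal_direction e n \<kappa>g \<kappa>t u =
     (\<kappa>t u *\<^sub>R e u + \<kappa>g u *\<^sub>R n u) /\<^sub>R sqrt ((\<kappa>t u)\<^sup>2 + (\<kappa>g u)\<^sup>2)"

definition ruled_surface ::
    "(real \<Rightarrow> real^3) \<Rightarrow> (real \<Rightarrow> real^3) \<Rightarrow> real \<Rightarrow> real \<Rightarrow> real^3" where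
  "ruled_surface c D u t = c u + t *\<^sub>R D u"

definition is_cone :: "real set \<Rightarrow> (real \<Rightarrow> real \<Rightarrow> real^3) \<Rightarrow> bool" where
  "is_cone I F \<longleftrightarrow> (\<exists>c. \<forall>u\<in>I. c \<in> range (F u))"

definition delta_o ::
    "(real \<Rightarrow> real) \<Rightarrow> (real \<Rightarrow> real) \<Rightarrow> (real \<Rightarrow> real) \<Rightarrow> real \<Rightarrow> real" where
  "delta_o \<kappa>g \<kappa>\<nu> \<kappa>t u =
     \<kappa>g u * ((\<kappa>\<nu> u)\<^sup>2 + (\<kappa>t u)\<^sup>2) - \<kappa>t u * deriv \<kappa>\<nu> u + deriv \<kappa>t u * \<kappa>\<nu> u"

definition delta_n ::
    "(real \<Rightarrow> real) \<Rightarrow> (real \<Rightarrow> real) \<Rightarrow> (real \<Rightarrow> real) \<Rightarrow> real \<Rightarrow> real" where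
  "delta_n \<kappa>g \<kappa>\<nu> \<kappa>t u =
     \<kappa>\<nu> u * ((\<kappa>g u)\<^sup>2 + (\<kappa>t u)\<^sup>2) - \<kappa>g u * deriv \<kappa>t u + \<kappa>t u * deriv \<kappa>g u"

definition sigma_o ::
    "(real \<Rightarrow> real) \<Rightarrow> (real \<Rightarrow> real) \<Rightarrow> (real \<Rightarrow> real) \<Rightarrow> (real \<Rightarrow> real) \<Rightarrow> real \<Rightarrow> real" where
  "sigma_o \<epsilon> \<kappa>g \<kappa>\<nu> \<kappa>t u =
     - \<epsilon> u * \<kappa>\<nu> u * deriv (delta_o \<kappa>g \<kappa>\<nu> \<kappa>t) u
     - (- deriv \<epsilon> u * \<kappa>\<nu> u + \<epsilon> u * \<kappa>g u * \<kappa>t u - 2 * \<epsilon> u * deriv \<kappa>\<nu> u) * delta_o \<kappa>g \<kappa>\<nu> \<kappa>t u"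

definition sigma_n ::
    "(real \<Rightarrow> real) \<Rightarrow> (real \<Rightarrow> real) \<Rightarrow> (real \<Rightarrow> real) \<Rightarrow> (real \<Rightarrow> real) \<Rightarrow> real \<Rightarrow> real" where
  "sigma_n \<epsilon> \<kappa>g \<kappa>\<nu> \<kappa>t u =
     - \<epsilon> u * \<kappa>g u * deriv (delta_n \<kappa>g \<kappa>\<nu> \<kappa>t) u
     + (deriv \<epsilon> u * \<kappa>g u + \<epsilon> u * \<kappa>\<nu> u * \<kappa>t u + 2 * \<epsilon> u * deriv \<kappa>g u) * delta_n \<kappa>g \<kappa>\<nu> \<kappa>t u"

definition striction_param_o ::
    "(real \<Rightarrow> real) \<Rightarrow> (real \<Rightarrow> real) \<Rightarrow> (real \<Rightarrow> real) \<Rightarrow> (real \<Rightarrow> real) \<Rightarrow> real \<Rightarrow> real" where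
  "striction_param_o \<epsilon> \<kappa>g \<kappa>\<nu> \<kappa>t u =
     - (\<kappa>\<nu> u * \<epsilon> u * sqrt ((\<kappa>\<nu> u)\<^sup>2 + (\<kappa>t u)\<^sup>2) / delta_o \<kappa>g \<kappa>\<nu> \<kappa>t u)"

definition striction_param_n ::
    "(real \<Rightarrow> real) \<Rightarrow> (real \<Rightarrow> real) \<Rightarrow> (real \<Rightarrow> real) \<Rightarrow> (real \<Rightarrow> real) \<Rightarrow> real \<Rightarrow> real" where
  "striction_param_n \<epsilon> \<kappa>g \<kappa>\<nu> \<kappa>t u =
     \<kappa>g u * \<epsilon> u * sqrt ((\<kappa>g u)\<^sup>2 + (\<kappa>t u)\<^sup>2) / delta_n \<kappa>g \<kappa>\<nu> \<kappa>t u"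

text \<open>The contour edge with center \<open>c\<close> along a field \<open>w\<close>: tangential for \<open>w = \<nu>\<close>, normal for \<open>w = b\<close>.\<close>

definition contour_edge ::
    "(real^2) set \<Rightarrow> real set \<Rightarrow> (real^2 \<Rightarrow> real^3) \<Rightarrow> (real \<Rightarrow> real^3) \<Rightarrow> real^3 \<Rightarrow> bool" where
  "contour_edge U I f w c \<longleftrightarrow>
     singular_set U f = {u_axis u |u. u \<in> I \<and> (f (u_axis u) - c) \<bullet> w u = 0}"

end

theory Submission
  imports Defs
begin

text \<open>
  Put \<open>D = \<kappa>t e - \<kappa>\<nu> b\<close>, which spans the rulings of \<open>OD\<close> and is orthogonal to \<open>n\<close>. A common point \<open>p\<close>
  of the rulings thus satisfies \<open>(f - p) \<bullet> n = 0\<close> along the singular curve. Conversely, differentiating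
  this equation twice yields \<open>(f - p) \<bullet> (\<kappa>\<nu> e + \<kappa>t b) = 0\<close> and one further linear equation with
  determinant \<open>\<delta>\<close>, which together force \<open>p = f - (\<epsilon> \<kappa>\<nu> / \<delta>) D\<close>; this is the striction curve. Its
  velocity is \<open>- (\<sigma> / \<delta>\<^sup>2) D\<close>, so it is constant iff \<open>\<sigma>\<close> vanishes. The statement on \<open>ND\<close> follows by
  exchanging \<open>b\<close> and \<open>n\<close>. The only input from the singularity is \<open>f' = \<epsilon> e\<close> with
  \<open>\<epsilon>\<close> differentiable: the smooth function \<open>f' \<bullet> e\<close> has a simple zero at \<open>0\<close> and no other zeros, so it
  changes sign there and coincides with \<open>sgn u \<bar>f'\<bar>\<close>.
\<close>

section \<open>Smooth curves\<close>

text \<open>The derivative is an existential witness constrained only on \<open>S\<close>, so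
  product and chain rules can supply it directly in inductions. Order 0 is trivial because only the
  existence of derivatives is used later.\<close>

primrec times_vderiv_on :: "nat \<Rightarrow> real set \<Rightarrow> (real \<Rightarrow> 'a::real_normed_vector) \<Rightarrow> bool" where
  "times_vderiv_on 0 S g \<longleftrightarrow> True"
| "times_vderiv_on (Suc k) S g \<longleftrightarrow>
     (\<exists>g'. (\<forall>u\<in>S. (g has_vector_derivative g' u) (at u)) \<and> times_vderiv_on k S g')"

lemma times_vderiv_on_SucI:
  assumes "\<And>u. u \<in> S \<Longrightarrow> (g has_vector_derivative g' u) (at u)" "times_vderiv_on k S g'"
  shows "times_vderiv_on (Suc k) S g"
  using assms by auto

lemma times_vderiv_on_SucD: "times_vderiv_on (Suc k) S g \<Longrightarrow> times_vderiv_on k S g"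
proof (induction k arbitrary: g)
  case (Suc k)
  then obtain g' where "\<forall>u\<in>S. (g has_vector_derivative g' u) (at u)" "times_vderiv_on (Suc k) S g'"
    by (metis times_vderiv_on.simps(2))
  then show ?case using Suc.IH[of g'] by (auto intro!: exI[of _ g'])
qed auto

lemma times_vderiv_on_cong:
  assumes "open S" "\<And>u. u \<in> S \<Longrightarrow> g u = h u" "times_vderiv_on k S g"
  shows "times_vderiv_on k S h"
proof (cases k)
  case (Suc j)
  with assms(3) obtain g' where
    "\<forall>u\<in>S. (g has_vector_derivative g' u) (at u)" "times_vderiv_on j S g'" by auto
  then show ?thesis
    using assms(1,2) unfolding Suc
    by (intro times_vderiv_on_SucI[of _ _ g'])
       (auto intro: has_vector_derivative_transform_within_open)
qed auto

lemma times_vderiv_on_add: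
  "times_vderiv_on k S g \<Longrightarrow> times_vderiv_on k S h \<Longrightarrow> times_vderiv_on k S (\<lambda>u. g u + h u)"
proof (induction k arbitrary: g h)
  case (Suc k)
  from Suc.prems obtain g' h' where
    "\<forall>u\<in>S. (g has_vector_derivative g' u) (at u)" "times_vderiv_on k S g'"
    "\<forall>u\<in>S. (h has_vector_derivative h' u) (at u)" "times_vderiv_on k S h'" by auto
  then show ?case
    by (intro times_vderiv_on_SucI[of _ _ "\<lambda>u. g' u + h' u"])
       (auto intro: Suc.IH has_vector_derivative_add)
qed auto

text \<open>The product rule yields two products of the same kind, one order lower. Stated for any
  bounded bilinear product, it serves for both the inner product and \<open>cross3\<close>.\<close>

lemma times_vderiv_on_bilinear:
  assumes "bounded_bilinear prd"
  shows "times_vderiv_on k S g \<Longrightarrow> times_vderiv_on k S h \<Longrightarrow>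
    times_vderiv_on k S (\<lambda>u. prd (g u) (h u))"
proof (induction k arbitrary: g h)
  case (Suc k)
  from Suc.prems obtain g' h' where
    *: "\<forall>u\<in>S. (g has_vector_derivative g' u) (at u)" "times_vderiv_on k S g'"
    "\<forall>u\<in>S. (h has_vector_derivative h' u) (at u)" "times_vderiv_on k S h'" by auto
  have "times_vderiv_on k S g" "times_vderiv_on k S h"
    using Suc.prems by (simp_all only: times_vderiv_on_SucD)
  with * show ?case
    by (intro times_vderiv_on_SucI[of _ _ "\<lambda>u. prd (g u) (h' u) + prd (g' u) (h u)"])
       (auto intro!: Suc.IH times_vderiv_on_add bounded_bilinear.has_vector_derivative[OF assms])
qed auto

lemma times_vderiv_on_linear:
  assumes "bounded_linear L"
  shows "times_vderiv_on k S g \<Longrightarrow> times_vderiv_on k S (\<lambda>u. L (g u))"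
proof (induction k arbitrary: g)
  case (Suc k)
  from Suc.prems obtain g' where
    "\<forall>u\<in>S. (g has_vector_derivative g' u) (at u)" "times_vderiv_on k S g'" by auto
  then show ?case
    by (intro times_vderiv_on_SucI[of _ _ "\<lambda>u. L (g' u)"])
       (auto intro!: Suc.IH bounded_linear.has_vector_derivative[OF assms])
qed auto

lemma times_vderiv_on_vderiv:
  assumes "open S" "times_vderiv_on (Suc k) S g"
  shows "times_vderiv_on k S (vderiv g)"
proof -
  from assms(2) obtain g' where
    "\<forall>u\<in>S. (g has_vector_derivative g' u) (at u)" "times_vderiv_on k S g'" by auto
  then show ?thesis
    by (auto intro!: times_vderiv_on_cong[OF assms(1), of g' "vderiv g"] simp: vector_derivative_at)
qed

lemma times_vderiv_on_has_vderiv: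
  assumes "times_vderiv_on (Suc k) S g" "u \<in> S"
  shows "(g has_vector_derivative vderiv g u) (at u)"
  using assms by (auto simp: vector_derivative_at)

lemma times_vderiv_on_has_deriv:
  fixes g :: "real \<Rightarrow> real"
  assumes "times_vderiv_on (Suc k) S g" "u \<in> S"
  shows "(g has_real_derivative deriv g u) (at u)"
  using times_vderiv_on_has_vderiv[OF assms]
  by (metis DERIV_imp_deriv has_real_derivative_iff_has_vector_derivative)

lemma times_vderiv_on_deriv:
  fixes g :: "real \<Rightarrow> real"
  assumes "open S" "times_vderiv_on (Suc k) S g"
  shows "times_vderiv_on k S (deriv g)"
proof (rule times_vderiv_on_cong[OF assms(1)])
  show "times_vderiv_on k S (vderiv g)" by (rule times_vderiv_on_vderiv[OF assms])
  show "vderiv g u = deriv g u" if "u \<in> S" for u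
    using times_vderiv_on_has_deriv[OF assms(2) that]
    by (simp add: has_real_derivative_iff_has_vector_derivative vector_derivative_at)
qed

text \<open>Since \<open>p\<close> has constant velocity \<open>v\<close>, the chain rule gives the
  directional derivative of \<open>g\<close> in the fixed direction \<open>v\<close>, again composed
  with \<open>p\<close>. This has the original form with one order less, so the induction
  closes.\<close>

lemma k_times_cont_diff_on_imp_times_vderiv_on:
  assumes "\<And>u. u \<in> S \<Longrightarrow> p u \<in> U" "\<And>u. u \<in> S \<Longrightarrow> (p has_vector_derivative v) (at u)"
  shows "k_times_cont_diff_on k U g \<Longrightarrow> times_vderiv_on k S (\<lambda>u. g (p u))"
proof (induction k arbitrary: g)
  case (Suc k)
  have "((\<lambda>u. g (p u)) has_vector_derivative frechet_derivative g (at (p u)) v) (at u)"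
    if "u \<in> S" for u
  proof -
    have "(g has_derivative frechet_derivative g (at (p u))) (at (p u))"
      using Suc.prems assms(1)[OF that] by (simp add: frechet_derivative_works)
    then show ?thesis
      using vector_derivative_diff_chain_within[OF assms(2)[OF that] has_derivative_at_withinI]
      by (simp add: o_def)
  qed
  moreover have "times_vderiv_on k S (\<lambda>u. frechet_derivative g (at (p u)) v)"
    using Suc.prems by (intro Suc.IH) auto
  ultimately show ?case by (rule times_vderiv_on_SucI)
qed auto

lemma smooth_on_imp_times_vderiv_on:
  assumes "smooth_on S g"
  shows "times_vderiv_on k S g"
  using assms k_times_cont_diff_on_imp_times_vderiv_on[of S "\<lambda>u. u" S 1 k g]
  by (auto simp: smooth_on_def has_vector_derivative_id)

text \<open>Allows an equation valid only on an open set to be differentiated there.\<close>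

lemma has_real_derivative_eq_0:
  fixes g :: "real \<Rightarrow> real"
  assumes "open S" "u \<in> S" "\<And>x. x \<in> S \<Longrightarrow> g x = 0" "(g has_real_derivative d) (at u)"
  shows "d = 0"
proof -
  have "((\<lambda>_. 0) has_real_derivative d) (at u)"
    by (rule has_field_derivative_transform_within_open[OF assms(4,1,2)]) (rule assms(3))
  then show ?thesis by (metis DERIV_const DERIV_unique)
qed

section \<open>Developable surfaces along a framed curve\<close>

text \<open>\<open>b\<close> is not tied to a cross product: the frame is orthonormal without a
  prescribed orientation, so \<open>b\<close> and \<open>n\<close> may be exchanged. The invariants
  need two derivatives because \<open>delta_o\<close> contains \<open>deriv \<kappa>\<nu>\<close>
  and \<open>deriv \<kappa>t\<close> and is itself differentiated in \<open>sigma_o\<close>; the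
  exchange puts \<open>\<kappa>g\<close> in the place of \<open>\<kappa>\<nu>\<close>.\<close>

locale framed_curve =
  fixes I :: "real set" and c e b n :: "real \<Rightarrow> real^3" and \<epsilon> \<kappa>g \<kappa>\<nu> \<kappa>t :: "real \<Rightarrow> real"
  assumes open_I: "open I" and interval_I: "is_interval I"
    and unit: "u \<in> I \<Longrightarrow> norm (e u) = 1" "u \<in> I \<Longrightarrow> norm (b u) = 1" "u \<in> I \<Longrightarrow> norm (n u) = 1"
    and orth: "u \<in> I \<Longrightarrow> e u \<bullet> b u = 0" "u \<in> I \<Longrightarrow> e u \<bullet> n u = 0" "u \<in> I \<Longrightarrow> b u \<bullet> n u = 0"
    and frame: "frame_invariants I e b n \<kappa>g \<kappa>\<nu> \<kappa>t"
    and velocity: "u \<in> I \<Longrightarrow> (c has_vector_derivative \<epsilon> u *\<^sub>R e u) (at u)"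
    and smooth_eps: "times_vderiv_on 1 I \<epsilon>"
    and smooth_kg: "times_vderiv_on 2 I \<kappa>g"
    and smooth_kn: "times_vderiv_on 2 I \<kappa>\<nu>"
    and smooth_kt: "times_vderiv_on 2 I \<kappa>t"
begin

text \<open>The coupling between \<open>b\<close> and \<open>n\<close> in the frame equations is
  antisymmetric, so the exchange reverses the sign of \<open>\<kappa>t\<close>, while
  \<open>\<kappa>g\<close> and \<open>\<kappa>\<nu>\<close> trade places.\<close>

lemma swap: "framed_curve I c e n b \<epsilon> \<kappa>\<nu> \<kappa>g (\<lambda>u. - \<kappa>t u)"
proof
  show "times_vderiv_on 2 I (\<lambda>u. - \<kappa>t u)"
    using times_vderiv_on_linear[OF bounded_linear_minus[OF bounded_linear_ident]] smooth_kt by blast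
  show "frame_invariants I e n b \<kappa>\<nu> \<kappa>g (\<lambda>u. - \<kappa>t u)"
    using frame by (auto simp: frame_invariants_def add.commute)
qed (use open_I interval_I unit orth velocity smooth_eps smooth_kg smooth_kn in \<open>auto simp: inner_commute\<close>)

lemma frame_inner:
  assumes "u \<in> I"
  shows "e u \<bullet> e u = 1" "b u \<bullet> b u = 1" "n u \<bullet> n u = 1"
    "e u \<bullet> b u = 0" "b u \<bullet> e u = 0" "e u \<bullet> n u = 0" "n u \<bullet> e u = 0" "b u \<bullet> n u = 0" "n u \<bullet> b u = 0"
  using unit[OF assms] orth[OF assms] by (auto simp: inner_commute norm_eq_1)

text \<open>Nonzero pairwise orthogonal vectors are independent, and three of them span
  \<open>real^3\<close>, so the orthonormal expansion applies.\<close>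

lemma frame_expand:
  assumes "u \<in> I"
  shows "x = (x \<bullet> e u) *\<^sub>R e u + (x \<bullet> b u) *\<^sub>R b u + (x \<bullet> n u) *\<^sub>R n u"
proof -
  let ?B = "{e u, b u, n u}"
  note F = frame_inner[OF assms]
  have ne: "e u \<noteq> b u" "e u \<noteq> n u" "b u \<noteq> n u" using F by (metis zero_neq_one)+
  have nz: "0 \<notin> ?B" using F by (metis inner_zero_left insertE singletonD zero_neq_one)
  have orthB: "pairwise orthogonal ?B"
    using F by (auto simp: pairwise_def orthogonal_def)
  then have "independent ?B" using nz by (rule pairwise_orthogonal_independent)
  moreover have "card ?B = DIM(real^3)" using ne by auto
  ultimately have "span ?B = UNIV"
    by (metis card_ge_dim_independent dim_UNIV le_refl subset_UNIV top.extremum_unique)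
  then have "(\<Sum>v\<in>?B. (x \<bullet> v) *\<^sub>R v) = x"
    using orthB unit[OF assms] by (intro orthonormal_basis_expand) auto
  then show ?thesis using ne by (simp add: add.assoc)
qed

lemmas [derivative_intros] = velocity
lemma frame_deriv [derivative_intros]:
  assumes "u \<in> I"
  shows "(e has_vector_derivative (\<kappa>g u *\<^sub>R b u + \<kappa>\<nu> u *\<^sub>R n u)) (at u)"
    "(b has_vector_derivative (- \<kappa>g u *\<^sub>R e u + \<kappa>t u *\<^sub>R n u)) (at u)"
    "(n has_vector_derivative (- \<kappa>\<nu> u *\<^sub>R e u - \<kappa>t u *\<^sub>R b u)) (at u)"
  using frame assms by (auto simp: frame_invariants_def)

lemma invariant_deriv [derivative_intros]:
  assumes "u \<in> I"
  shows "(\<epsilon> has_real_derivative deriv \<epsilon> u) (at u)"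
    "(\<kappa>g has_real_derivative deriv \<kappa>g u) (at u)"
    "(\<kappa>\<nu> has_real_derivative deriv \<kappa>\<nu> u) (at u)"
    "(\<kappa>t has_real_derivative deriv \<kappa>t u) (at u)"
    "(deriv \<kappa>\<nu> has_real_derivative deriv (deriv \<kappa>\<nu>) u) (at u)"
    "(deriv \<kappa>t has_real_derivative deriv (deriv \<kappa>t) u) (at u)"
  using smooth_eps smooth_kg smooth_kn smooth_kt assms open_I
  by (auto simp: numeral_2_eq_2 simp del: times_vderiv_on.simps
      intro!: times_vderiv_on_has_deriv times_vderiv_on_deriv)

abbreviation "\<delta> \<equiv> delta_o \<kappa>g \<kappa>\<nu> \<kappa>t"
abbreviation "ruling u \<equiv> \<kappa>t u *\<^sub>R e u - \<kappa>\<nu> u *\<^sub>R b u"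
abbreviation "striction u \<equiv> ruled_surface c (osc_direction e b \<kappa>\<nu> \<kappa>t) u
  (striction_param_o \<epsilon> \<kappa>g \<kappa>\<nu> \<kappa>t u)"

section \<open>The striction curve and its velocity\<close>

lemma delta_deriv:
  assumes "u \<in> I"
  shows "(\<delta> has_real_derivative deriv \<delta> u) (at u)"
proof -
  \<comment> \<open>Only existence matters: \<open>sigma_o\<close> mentions
    \<open>deriv \<delta>\<close> itself, so its value is never expanded.\<close>
  have "\<exists>d. (\<delta> has_real_derivative d) (at u)"
    unfolding delta_o_def[abs_def]
    by (rule exI) (rule derivative_eq_intros assms refl | simp)+
  then show ?thesis using DERIV_deriv_iff_has_field_derivative by blast
qed

text \<open>The square root normalising the ruling cancels against the one in the striction
  parameter, leaving an expression that is rational in the invariants.\<close>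

lemma striction_eq:
  assumes "(\<kappa>t u)\<^sup>2 + (\<kappa>\<nu> u)\<^sup>2 \<noteq> 0"
  shows "striction u = c u - (\<epsilon> u * \<kappa>\<nu> u / \<delta> u) *\<^sub>R ruling u"
proof -
  have "sqrt ((\<kappa>t u)\<^sup>2 + (\<kappa>\<nu> u)\<^sup>2) \<noteq> 0" using assms by simp
  then show ?thesis
    by (simp add: ruled_surface_def osc_direction_def striction_param_o_def add.commute field_simps)
qed

text \<open>Both the velocity of the curve and the derivative of the ruling lie in the plane of
  \<open>e\<close> and \<open>b\<close>. Comparing the two components with those of the ruling
  yields the same factor twice.\<close>

lemma striction_deriv:
  assumes "u \<in> I" "(\<kappa>t u)\<^sup>2 + (\<kappa>\<nu> u)\<^sup>2 \<noteq> 0" "\<delta> u \<noteq> 0"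
  shows "((\<lambda>u. c u - (\<epsilon> u * \<kappa>\<nu> u / \<delta> u) *\<^sub>R ruling u) has_vector_derivative
    - (sigma_o \<epsilon> \<kappa>g \<kappa>\<nu> \<kappa>t u / (\<delta> u)\<^sup>2) *\<^sub>R ruling u) (at u)"
proof -
  define \<rho> where "\<rho> u = \<epsilon> u * \<kappa>\<nu> u / \<delta> u" for u
  define \<rho>' where "\<rho>' = ((deriv \<epsilon> u * \<kappa>\<nu> u + \<epsilon> u * deriv \<kappa>\<nu> u) * \<delta> u -
      \<epsilon> u * \<kappa>\<nu> u * deriv \<delta> u) / (\<delta> u)\<^sup>2"
  have \<rho>: "(\<rho> has_real_derivative \<rho>') (at u)"
    unfolding \<rho>_def[abs_def] \<rho>'_def
    using assms(3)
    by (auto intro!: derivative_eq_intros delta_deriv assms(1) simp: power2_eq_square field_simps)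
  \<comment> \<open>The \<open>n\<close>-components \<open>\<kappa>t u * \<kappa>\<nu> u\<close> of
    the two terms cancel.\<close>
  define D' where "D' = (deriv \<kappa>t u + \<kappa>\<nu> u * \<kappa>g u) *\<^sub>R e u + (\<kappa>t u * \<kappa>g u - deriv \<kappa>\<nu> u) *\<^sub>R b u"
  have D: "((\<lambda>u. ruling u) has_vector_derivative D') (at u)"
    unfolding D'_def using assms(1)
    by (auto intro!: derivative_eq_intros simp: algebra_simps)
  have "((\<lambda>u. c u - \<rho> u *\<^sub>R ruling u) has_vector_derivative
      \<epsilon> u *\<^sub>R e u - (\<rho> u *\<^sub>R D' + \<rho>' *\<^sub>R ruling u)) (at u)"
    using assms(1) by (intro derivative_intros \<rho> D)
  also have "\<epsilon> u *\<^sub>R e u - (\<rho> u *\<^sub>R D' + \<rho>' *\<^sub>R ruling u) =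
      (\<epsilon> u - \<rho> u * (deriv \<kappa>t u + \<kappa>\<nu> u * \<kappa>g u) - \<rho>' * \<kappa>t u) *\<^sub>R e u +
      (\<rho>' * \<kappa>\<nu> u - \<rho> u * (\<kappa>t u * \<kappa>g u - deriv \<kappa>\<nu> u)) *\<^sub>R b u"
    by (simp add: D'_def algebra_simps)
  also have "\<epsilon> u - \<rho> u * (deriv \<kappa>t u + \<kappa>\<nu> u * \<kappa>g u) - \<rho>' * \<kappa>t u =
      - (sigma_o \<epsilon> \<kappa>g \<kappa>\<nu> \<kappa>t u / (\<delta> u)\<^sup>2) * \<kappa>t u"
  proof -
    have r: "\<rho> u * \<delta> u = \<epsilon> u * \<kappa>\<nu> u"
      "\<rho>' * (\<delta> u)\<^sup>2 = (deriv \<epsilon> u * \<kappa>\<nu> u + \<epsilon> u * deriv \<kappa>\<nu> u) * \<delta> u - \<epsilon> u * \<kappa>\<nu> u * deriv \<delta> u"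
      using assms(3) by (simp_all add: \<rho>_def \<rho>'_def)
    \<comment> \<open>\<open>\<delta>\<close> is kept opaque here; the two sides differ only by a
      multiple of \<open>\<delta> u\<close> minus its defining expression, which vanishes in the
      next step. The \<open>b\<close>-component below needs no unfolding of \<open>\<delta>\<close>
      at all.\<close>
    have "\<epsilon> u * (\<delta> u)\<^sup>2 - \<epsilon> u * \<kappa>\<nu> u * \<delta> u * (deriv \<kappa>t u + \<kappa>\<nu> u * \<kappa>g u) -
      ((deriv \<epsilon> u * \<kappa>\<nu> u + \<epsilon> u * deriv \<kappa>\<nu> u) * \<delta> u - \<epsilon> u * \<kappa>\<nu> u * deriv \<delta> u) * \<kappa>t u =
      - sigma_o \<epsilon> \<kappa>g \<kappa>\<nu> \<kappa>t u * \<kappa>t u + \<epsilon> u * \<delta> u *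
      (\<delta> u - (\<kappa>g u * ((\<kappa>\<nu> u)\<^sup>2 + (\<kappa>t u)\<^sup>2) - \<kappa>t u * deriv \<kappa>\<nu> u + deriv \<kappa>t u * \<kappa>\<nu> u))"
      unfolding sigma_o_def by (simp add: algebra_simps power2_eq_square)
    also have "\<dots> = - sigma_o \<epsilon> \<kappa>g \<kappa>\<nu> \<kappa>t u * \<kappa>t u"
      by (simp add: delta_o_def)
    also have "\<epsilon> u * (\<delta> u)\<^sup>2 - \<epsilon> u * \<kappa>\<nu> u * \<delta> u * (deriv \<kappa>t u + \<kappa>\<nu> u * \<kappa>g u) -
      ((deriv \<epsilon> u * \<kappa>\<nu> u + \<epsilon> u * deriv \<kappa>\<nu> u) * \<delta> u - \<epsilon> u * \<kappa>\<nu> u * deriv \<delta> u) * \<kappa>t u =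
      (\<epsilon> u - \<rho> u * (deriv \<kappa>t u + \<kappa>\<nu> u * \<kappa>g u) - \<rho>' * \<kappa>t u) * (\<delta> u)\<^sup>2"
      using r by algebra
    finally have "\<epsilon> u - \<rho> u * (deriv \<kappa>t u + \<kappa>\<nu> u * \<kappa>g u) - \<rho>' * \<kappa>t u =
      - sigma_o \<epsilon> \<kappa>g \<kappa>\<nu> \<kappa>t u * \<kappa>t u / (\<delta> u)\<^sup>2"
      using assms(3) by (intro eq_divide_imp) auto
    then show ?thesis by simp
  qed
  also have "\<rho>' * \<kappa>\<nu> u - \<rho> u * (\<kappa>t u * \<kappa>g u - deriv \<kappa>\<nu> u) =
      (sigma_o \<epsilon> \<kappa>g \<kappa>\<nu> \<kappa>t u / (\<delta> u)\<^sup>2) * \<kappa>\<nu> u"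
    unfolding \<rho>_def \<rho>'_def sigma_o_def
    using assms(3) by (simp add: field_simps power2_eq_square)
  finally show ?thesis by (simp add: \<rho>_def algebra_simps)
qed

lemma ruling_nonzero:
  assumes "u \<in> I" "(\<kappa>t u)\<^sup>2 + (\<kappa>\<nu> u)\<^sup>2 \<noteq> 0"
  shows "ruling u \<noteq> 0"
proof
  assume *: "ruling u = 0"
  have "ruling u \<bullet> ruling u = (\<kappa>t u)\<^sup>2 + (\<kappa>\<nu> u)\<^sup>2"
    using frame_inner[OF assms(1)] by (simp add: inner_simps power2_eq_square)
  with * assms(2) show False by simp
qed

text \<open>The velocity is a multiple of the nonvanishing ruling, so it is zero exactly when
  \<open>sigma_o\<close> is. The converse passes from zero derivative to constancy on the convex set
  \<open>I\<close>.\<close>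

lemma striction_constant_iff:
  assumes "\<forall>u\<in>I. (\<kappa>t u)\<^sup>2 + (\<kappa>\<nu> u)\<^sup>2 \<noteq> 0 \<and> \<delta> u \<noteq> 0"
  shows "striction constant_on I \<longleftrightarrow> (\<forall>u\<in>I. sigma_o \<epsilon> \<kappa>g \<kappa>\<nu> \<kappa>t u = 0)"
proof -
  have D: "(striction has_vector_derivative
    - (sigma_o \<epsilon> \<kappa>g \<kappa>\<nu> \<kappa>t u / (\<delta> u)\<^sup>2) *\<^sub>R ruling u) (at u)" if "u \<in> I" for u
    by (rule has_vector_derivative_transform_within_open[OF striction_deriv open_I])
       (use assms that in \<open>auto simp: striction_eq\<close>)
  show ?thesis
  proof
    assume "striction constant_on I"
    then obtain p where p: "\<And>u. u \<in> I \<Longrightarrow> striction u = p" by (auto simp: constant_on_def)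
    show "\<forall>u\<in>I. sigma_o \<epsilon> \<kappa>g \<kappa>\<nu> \<kappa>t u = 0"
    proof
      fix u assume u: "u \<in> I"
      have "((\<lambda>_. p) has_vector_derivative
        - (sigma_o \<epsilon> \<kappa>g \<kappa>\<nu> \<kappa>t u / (\<delta> u)\<^sup>2) *\<^sub>R ruling u) (at u)"
        by (rule has_vector_derivative_transform_within_open[OF D open_I]) (use u p in auto)
      then have "- (sigma_o \<epsilon> \<kappa>g \<kappa>\<nu> \<kappa>t u / (\<delta> u)\<^sup>2) *\<^sub>R ruling u = 0"
        using has_vector_derivative_const vector_derivative_unique_at by blast
      then show "sigma_o \<epsilon> \<kappa>g \<kappa>\<nu> \<kappa>t u = 0"
        using ruling_nonzero[OF u] assms u by auto
    qed
  next
    assume "\<forall>u\<in>I. sigma_o \<epsilon> \<kappa>g \<kappa>\<nu> \<kappa>t u = 0"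
    then have "(striction has_derivative (\<lambda>_. 0)) (at u within I)" if "u \<in> I" for u
      using D[OF that] that by (auto simp: has_vector_derivative_def has_derivative_at_withinI)
    then show "striction constant_on I"
      using has_derivative_zero_constant[of I striction] interval_I
      by (auto simp: constant_on_def is_interval_convex)
  qed
qed

text \<open>The first two derivatives of the contour equation determine the \<open>e\<close>- and
  \<open>b\<close>-coordinates of \<open>c u - p\<close>, and the equation itself kills the
  \<open>n\<close>-coordinate.\<close>

lemma contour_imp_striction:
  assumes "\<forall>u\<in>I. (\<kappa>t u)\<^sup>2 + (\<kappa>\<nu> u)\<^sup>2 \<noteq> 0 \<and> \<delta> u \<noteq> 0"
    and contour: "\<forall>u\<in>I. (c u - p) \<bullet> n u = 0" and u: "u \<in> I"
  shows "striction u = p"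
proof -
  have first: "(c u - p) \<bullet> (\<kappa>\<nu> u *\<^sub>R e u + \<kappa>t u *\<^sub>R b u) = 0" if u: "u \<in> I" for u
  proof -
    have "((\<lambda>u. (c u - p) \<bullet> n u) has_vector_derivative
      (c u - p) \<bullet> (- \<kappa>\<nu> u *\<^sub>R e u - \<kappa>t u *\<^sub>R b u) + (\<epsilon> u *\<^sub>R e u - 0) \<bullet> n u) (at u)"
      by (intro bounded_bilinear.has_vector_derivative[OF bounded_bilinear_inner] derivative_intros u)
    from has_real_derivative_eq_0[OF open_I u _ this[folded has_real_derivative_iff_has_vector_derivative]]
    show ?thesis using contour frame_inner[OF u] by (simp add: inner_simps)
  qed
  define P' where "P' = \<kappa>\<nu> u *\<^sub>R (\<kappa>g u *\<^sub>R b u + \<kappa>\<nu> u *\<^sub>R n u) + deriv \<kappa>\<nu> u *\<^sub>R e u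
     + (\<kappa>t u *\<^sub>R (- \<kappa>g u *\<^sub>R e u + \<kappa>t u *\<^sub>R n u) + deriv \<kappa>t u *\<^sub>R b u)"
  have "((\<lambda>u. (c u - p) \<bullet> (\<kappa>\<nu> u *\<^sub>R e u + \<kappa>t u *\<^sub>R b u)) has_vector_derivative
      (c u - p) \<bullet> P' + (\<epsilon> u *\<^sub>R e u - 0) \<bullet> (\<kappa>\<nu> u *\<^sub>R e u + \<kappa>t u *\<^sub>R b u)) (at u)"
    unfolding P'_def
    by (intro bounded_bilinear.has_vector_derivative[OF bounded_bilinear_inner] derivative_intros u)
  from has_real_derivative_eq_0[OF open_I u first this[folded has_real_derivative_iff_has_vector_derivative]]
  \<comment> \<open>The velocity of \<open>c\<close> drops out of the first derivative because
    \<open>e\<close> is orthogonal to \<open>n\<close>; here it contributes the inhomogeneous term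
    \<open>\<epsilon> u * \<kappa>\<nu> u\<close>.\<close>
  have P'0: "(c u - p) \<bullet> P' + \<epsilon> u * \<kappa>\<nu> u = 0"
    using frame_inner[OF u] by (simp add: inner_simps mult.commute)
  define x y where "x = (c u - p) \<bullet> e u" and "y = (c u - p) \<bullet> b u"
  have n0: "(c u - p) \<bullet> n u = 0" using contour u by blast
  have "(c u - p) \<bullet> P' = \<kappa>\<nu> u * (\<kappa>g u * y) + deriv \<kappa>\<nu> u * x + (\<kappa>t u * (- \<kappa>g u * x) + deriv \<kappa>t u * y)"
    by (simp add: P'_def inner_add_right inner_diff_right n0 x_def y_def)
  with P'0 have 2: "x * (deriv \<kappa>\<nu> u - \<kappa>t u * \<kappa>g u) + y * (deriv \<kappa>t u + \<kappa>\<nu> u * \<kappa>g u) + \<epsilon> u * \<kappa>\<nu> u = 0"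
    by (simp add: algebra_simps)
  have 1: "x * \<kappa>\<nu> u + y * \<kappa>t u = 0"
    using first[OF u] by (simp add: x_def y_def inner_add_right algebra_simps)
  \<comment> \<open>Cramer's rule for the linear system \<open>1\<close>, \<open>2\<close> in
    \<open>x\<close> and \<open>y\<close>, whose determinant is \<open>\<delta> u\<close>.\<close>
  have "x * \<delta> u = \<epsilon> u * \<kappa>\<nu> u * \<kappa>t u" "y * \<delta> u = - (\<epsilon> u * \<kappa>\<nu> u * \<kappa>\<nu> u)"
    using 1 2 unfolding delta_o_def by algebra+
  then have xy: "x = (\<epsilon> u * \<kappa>\<nu> u / \<delta> u) * \<kappa>t u" "y = - (\<epsilon> u * \<kappa>\<nu> u / \<delta> u) * \<kappa>\<nu> u"
    using assms(1) u by (auto simp: field_simps)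
  have "c u - p = x *\<^sub>R e u + y *\<^sub>R b u"
    using frame_expand[OF u, of "c u - p"] n0 by (simp add: x_def y_def)
  also have "\<dots> = (\<epsilon> u * \<kappa>\<nu> u / \<delta> u) *\<^sub>R ruling u"
    unfolding xy by (simp add: algebra_simps)
  finally show ?thesis
    using striction_eq[of u] assms(1) u by (auto simp: algebra_simps)
qed

text \<open>The implications run in a cycle: the rulings are orthogonal to \<open>n\<close>, so a
  vertex is a contour center; a center equals every striction point; and a constant striction point
  lies on all rulings.\<close>

lemma cone_iff_contour:
  assumes "\<forall>u\<in>I. (\<kappa>t u)\<^sup>2 + (\<kappa>\<nu> u)\<^sup>2 \<noteq> 0 \<and> \<delta> u \<noteq> 0"
  shows "is_cone I (ruled_surface c (osc_direction e b \<kappa>\<nu> \<kappa>t)) \<longleftrightarrow>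
      (\<exists>p. \<forall>u\<in>I. (c u - p) \<bullet> n u = 0)" (is "?cone \<longleftrightarrow> ?contour")
    and "is_cone I (ruled_surface c (osc_direction e b \<kappa>\<nu> \<kappa>t)) \<longleftrightarrow> striction constant_on I"
      (is "_ \<longleftrightarrow> ?const")
proof -
  have 1: ?contour if ?cone
  proof -
    from that obtain p where p: "\<And>u. u \<in> I \<Longrightarrow> p \<in> range (ruled_surface c (osc_direction e b \<kappa>\<nu> \<kappa>t) u)"
      by (auto simp: is_cone_def)
    have "(c u - p) \<bullet> n u = 0" if u: "u \<in> I" for u
      using p[OF u] frame_inner[OF u]
      by (auto simp: ruled_surface_def osc_direction_def inner_simps)
    then show ?thesis by blast
  qed
  have 2: ?const if ?contour
    using that contour_imp_striction[OF assms] unfolding constant_on_def by blast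
  have 3: ?cone if ?const
    using that unfolding constant_on_def is_cone_def by (metis rangeI)
  show "?cone \<longleftrightarrow> ?contour" "?cone \<longleftrightarrow> ?const" using 1 2 3 by blast+
qed

end

section \<open>Singular points of the second kind\<close>

lemma u_axis_eq: "u_axis u = u *\<^sub>R axis 1 1"
  by (simp add: u_axis_def vec_eq_iff forall_2 axis_def)

lemma u_axis_has_vector_derivative: "(u_axis has_vector_derivative axis 1 1) (at u)"
  unfolding u_axis_eq[abs_def] by (auto intro!: derivative_eq_intros)

lemma inj_u_axis: "u_axis x = u_axis y \<longleftrightarrow> x = y"
  by (simp add: u_axis_def vec_eq_iff forall_2)

lemma smooth_on_u_axis:
  assumes "smooth_on U g" "\<And>u. u \<in> I \<Longrightarrow> u_axis u \<in> U"
  shows "times_vderiv_on k I (\<lambda>u. g (u_axis u))"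
  using assms(1) unfolding smooth_on_def
  by (intro k_times_cont_diff_on_imp_times_vderiv_on[OF assms(2) u_axis_has_vector_derivative]) auto

lemma vderiv_sing_image:
  assumes "f differentiable at (u_axis u)"
  shows "(sing_image f has_vector_derivative frechet_derivative f (at (u_axis u)) (axis 1 1)) (at u)"
  using vector_derivative_diff_chain_within[OF u_axis_has_vector_derivative has_derivative_at_withinI]
    assms by (simp add: o_def sing_image_def[abs_def] frechet_derivative_works)

text \<open>The parametrization \<open>\<gamma>\<close> runs inside the \<open>u\<close>-axis, so \<open>\<gamma>'(0)\<close> is a multiple of \<open>(1, 0)\<close>; as
  \<open>\<phi> 0 = 0\<close>, it is also a multiple of the null vector \<open>\<eta> 0\<close>.\<close>

lemma second_kind_imp_null_u:
  assumes "second_kind_singular U f \<nu> 0" "singular_set U f \<subseteq> {p. p $ 2 = 0}"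
    and diff: "f differentiable at 0"
  shows "frechet_derivative f (at 0) (axis 1 1) = 0"
proof -
  obtain J W and \<gamma> \<eta> :: "real \<Rightarrow> real^2" where J: "open J" "0 \<in> J"
    and \<gamma>: "smooth_on J \<gamma>" "vderiv \<gamma> 0 \<noteq> 0" "\<gamma> 0 = 0" "\<gamma> ` J = singular_set U f \<inter> W"
    and \<eta>: "\<eta> 0 \<noteq> 0" "{X. frechet_derivative f (at (\<gamma> 0)) X = 0} = span {\<eta> 0}"
    and \<phi>: "det (vector [vderiv \<gamma> 0, \<eta> 0] :: real^2^2) = 0"
    using assms(1) unfolding second_kind_singular_def Let_def by blast
  have "(\<gamma> has_vector_derivative vderiv \<gamma> 0) (at 0)"
    using times_vderiv_on_has_vderiv[OF smooth_on_imp_times_vderiv_on] \<gamma>(1) J(2) by blast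
  then have "((\<lambda>t. \<gamma> t $ 2) has_real_derivative vderiv \<gamma> 0 $ 2) (at 0)"
    unfolding has_real_derivative_iff_has_vector_derivative
    by (rule bounded_linear.has_vector_derivative[OF bounded_linear_vec_nth])
  moreover have "\<gamma> t $ 2 = 0" if "t \<in> J" for t
    using \<gamma>(4) that assms(2) by blast
  ultimately have \<gamma>2: "vderiv \<gamma> 0 $ 2 = 0"
    by (rule has_real_derivative_eq_0[OF J, rotated])
  with \<gamma>(2) have \<gamma>1: "vderiv \<gamma> 0 $ 1 \<noteq> 0" by (auto simp: vec_eq_iff forall_2)
  with \<phi> \<gamma>2 have \<eta>2: "\<eta> 0 $ 2 = 0" by (simp add: det_2)
  have "\<eta> 0 $ 1 \<noteq> 0" using \<eta>(1) \<eta>2 by (auto simp: vec_eq_iff forall_2)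
  then have "axis 1 1 = (1 / \<eta> 0 $ 1) *\<^sub>R \<eta> 0"
    using \<eta>2 by (simp add: vec_eq_iff forall_2 axis_def)
  then have "axis 1 1 \<in> span {\<eta> 0}" by (metis span_base span_scale insertI1)
  then show ?thesis using \<eta>(2) \<gamma>(3) by auto
qed

section \<open>The signed speed and the Darboux frame along the singular curve\<close>

lemma nonzero_on_interval_same_sign:
  fixes a :: "real \<Rightarrow> real"
  assumes "is_interval S" "continuous_on S a" "\<And>x. x \<in> S \<Longrightarrow> a x \<noteq> 0" "x \<in> S" "y \<in> S" "0 < a x"
  shows "0 < a y"
proof (rule ccontr)
  assume "\<not> 0 < a y"
  have "connected (a ` S)"
    using assms(1,2) connected_continuous_image is_interval_connected by blast
  then have "0 \<in> a ` S"
    using connectedD_interval[of "a ` S" "a y" "a x" 0] assms(4-6) \<open>\<not> 0 < a y\<close> by auto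
  then show False using assms(3) by auto
qed

text \<open>The function \<open>a\<close> is differentiable by construction, and tangency gives
  \<open>a u *\<^sub>R e u\<close> as the velocity. It remains to match its sign with
  \<open>sgn u\<close>: the limit defining \<open>e 0\<close> makes \<open>a\<close> positive on the
  right, and the simple zero at 0 makes it negative on the left.\<close>

lemma signed_speed_eq:
  assumes frontal: "frontal_with_normal U f \<nu>"
    and second_kind: "second_kind_singular U f \<nu> 0"
    and coords: "adapted_coordinates U I f \<nu>"
    and tangent: "darboux_tangent I f e"
    and u: "u \<in> I"
  shows "signed_speed f u = vderiv (sing_image f) u \<bullet> e u"
    and "vderiv (sing_image f) u = signed_speed f u *\<^sub>R e u"
proof -
  define a where "a u = vderiv (sing_image f) u \<bullet> e u" for u
  have I: "open I" "is_interval I" "0 \<in> I" and axis: "\<And>u. u \<in> I \<Longrightarrow> u_axis u \<in> U"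
    using coords by (auto simp: adapted_coordinates_def)
  have smooth_f: "smooth_on U f" and U: "0 \<in> U" using frontal by (auto simp: frontal_with_normal_def)
  have smooth_e: "smooth_on I e" and norm_e: "\<And>u. u \<in> I \<Longrightarrow> norm (e u) = 1"
    and span_e: "\<And>u. u \<in> I \<Longrightarrow> u \<noteq> 0 \<Longrightarrow> e u \<in> span {vderiv (sing_image f) u}"
    and lim_e: "((\<lambda>u. vderiv (sing_image f) u /\<^sub>R norm (vderiv (sing_image f) u)) \<longlongrightarrow> e 0) (at_right 0)"
    using tangent by (auto simp: darboux_tangent_def)
  note Te = smooth_on_imp_times_vderiv_on[OF smooth_e]
  have Tc: "times_vderiv_on k I (sing_image f)" for k
    unfolding sing_image_def[abs_def] by (rule smooth_on_u_axis[OF smooth_f axis])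
  note Tc' = times_vderiv_on_vderiv[OF I(1) Tc]
  have Ta: "times_vderiv_on k I a" for k
    unfolding a_def[abs_def] by (rule times_vderiv_on_bilinear[OF bounded_bilinear_inner Tc' Te])
  have Da: "(a has_real_derivative deriv a u) (at u)" if "u \<in> I" for u
    using times_vderiv_on_has_deriv[OF Ta that] .
  then have cont_a: "continuous_on I a"
    by (meson DERIV_isCont continuous_at_imp_continuous_on)
  have diff0: "f differentiable at 0"
    using smooth_f U unfolding smooth_on_def by (metis k_times_cont_diff_on.simps(2))
  have "singular_set U f \<subseteq> {p. p $ 2 = 0}" using coords by (auto simp: adapted_coordinates_def)
  from second_kind_imp_null_u[OF second_kind this diff0] vderiv_sing_image[of f 0] diff0
  have c'0: "vderiv (sing_image f) 0 = 0" by (simp add: u_axis_eq vector_derivative_at)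
  have c': "vderiv (sing_image f) u = a u *\<^sub>R e u" and a_nz: "u \<noteq> 0 \<Longrightarrow> a u \<noteq> 0" if u: "u \<in> I" for u
  proof -
    have ee: "e u \<bullet> e u = 1" using norm_e[OF u] by (simp add: norm_eq_1)
    have *: "u \<noteq> 0 \<longrightarrow> vderiv (sing_image f) u = a u *\<^sub>R e u \<and> a u \<noteq> 0"
    proof
      assume "u \<noteq> 0"
      obtain k where k: "e u = k *\<^sub>R vderiv (sing_image f) u"
        using span_e[OF u] \<open>u \<noteq> 0\<close> by (auto simp: span_singleton)
      then have "k \<noteq> 0" using ee by auto
      then have eq: "vderiv (sing_image f) u = (1 / k) *\<^sub>R e u" using k by simp
      then have "a u = 1 / k" using ee unfolding a_def eq by simp
      then show "vderiv (sing_image f) u = a u *\<^sub>R e u \<and> a u \<noteq> 0" using eq \<open>k \<noteq> 0\<close> by simp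
    qed
    have "vderiv (sing_image f) 0 = a 0 *\<^sub>R e 0" by (simp add: a_def c'0)
    with * show "vderiv (sing_image f) u = a u *\<^sub>R e u" "u \<noteq> 0 \<Longrightarrow> a u \<noteq> 0"
      by blast+
  qed
  have a0: "a 0 = 0" by (simp add: a_def c'0)
  obtain d where d: "d > 0" "ball 0 d \<subseteq> I" using I(1,3) openE by blast
  have a_pos: "0 < a u" if u: "u \<in> I" "0 < u" for u
  proof (rule ccontr)
    assume "\<not> 0 < a u"
    have neg: "a x < 0" if x: "x \<in> I" "0 < x" for x
    proof (rule ccontr)
      assume "\<not> a x < 0"
      then have "0 < a x" using a_nz[OF x(1)] x(2) by auto
      then have "0 < a u"
        using nonzero_on_interval_same_sign[OF is_interval_Int[OF I(2) is_interval_oi[of 0]], of a x u]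
          continuous_on_subset[OF cont_a] a_nz x u by auto
      then show False using \<open>\<not> 0 < a u\<close> by simp
    qed
    \<comment> \<open>If \<open>a\<close> were negative on the right, the unit tangents would be
      \<open>- e x\<close> and tend to \<open>- e 0\<close>, against the choice of
      \<open>e 0\<close>.\<close>
    have "\<forall>\<^sub>F x in at_right 0. vderiv (sing_image f) x /\<^sub>R norm (vderiv (sing_image f) x) = - e x"
      unfolding eventually_at_right_field
    proof (intro exI[of _ d] conjI allI impI)
      fix x assume x: "0 < x" "x < d"
      then have "x \<in> I" using d by (auto simp: subset_iff dist_real_def)
      then show "vderiv (sing_image f) x /\<^sub>R norm (vderiv (sing_image f) x) = - e x"
        using c' neg[of x] norm_e x by (simp add: field_simps)
    qed (use d in auto)
    from Lim_transform_eventually[OF lim_e this] have "((\<lambda>x. - e x) \<longlongrightarrow> e 0) (at_right 0)" .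
    moreover have "isCont e 0"
      using times_vderiv_on_has_vderiv[OF Te I(3)] has_vector_derivative_continuous by blast
    then have "((\<lambda>x. - e x) \<longlongrightarrow> - e 0) (at_right 0)"
      by (intro tendsto_minus) (simp add: isCont_def filterlim_at_split)
    ultimately have "e 0 = - e 0" using tendsto_unique trivial_limit_at_right_real by blast
    then have "e 0 = 0" by (simp add: eq_neg_iff_add_eq_0 flip: scaleR_2)
    then show False using norm_e[OF I(3)] by simp
  qed
  \<comment> \<open>As \<open>a 0 = 0\<close>, the second derivative of the curve at 0 is
    \<open>deriv a 0 *\<^sub>R e 0\<close>. It is nonzero because the orientation determinant is
    positive, and a negative slope would contradict \<open>a_pos\<close>.\<close>
  have "deriv a 0 > 0"
  proof -
    have "(e has_vector_derivative vderiv e 0) (at 0)"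
      using times_vderiv_on_has_vderiv[OF Te I(3)] .
    from has_vector_derivative_scaleR[OF Da[OF I(3)] this]
    have "((\<lambda>u. a u *\<^sub>R e u) has_vector_derivative deriv a 0 *\<^sub>R e 0) (at 0)" by (simp add: a0)
    then have "(vderiv (sing_image f) has_vector_derivative deriv a 0 *\<^sub>R e 0) (at 0)"
      by (rule has_vector_derivative_transform_within_open[OF _ I(1,3)]) (simp add: c')
    then have "vderiv (vderiv (sing_image f)) 0 = deriv a 0 *\<^sub>R e 0"
      by (rule vector_derivative_at)
    moreover have "(vderiv ^^ 2) (sing_image f) 0 \<noteq> 0"
      using coords by (auto simp: adapted_coordinates_def det_3)
    ultimately have "deriv a 0 \<noteq> 0" by (auto simp: numeral_2_eq_2)
    moreover have False if lt0: "deriv a 0 < 0"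
    proof -
      obtain d' where d': "d' > 0" "\<And>h. 0 < h \<Longrightarrow> h < d' \<Longrightarrow> a (0 + h) < a 0"
        using DERIV_neg_dec_right[OF Da[OF I(3)] lt0] by auto
      have "min d d' / 2 \<in> I" using d d'(1) by (auto simp: subset_iff dist_real_def)
      then show False using a_pos[of "min d d' / 2"] d'(2)[of "min d d' / 2"] d(1) d'(1) a0 by force
    qed
    ultimately show ?thesis by fastforce
  qed
  then obtain d' where d': "d' > 0" "\<And>h. 0 < h \<Longrightarrow> h < d' \<Longrightarrow> a (0 - h) < a 0"
    using DERIV_pos_inc_left[OF Da[OF I(3)]] by auto
  \<comment> \<open>A point left of 0, within \<open>I\<close> and close enough for the positive
    slope to force \<open>a z < 0\<close>; this sign then spreads over the negative part of
    \<open>I\<close>.\<close>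
  define z where "z = - (min d d' / 2)"
  have z: "z \<in> I" "z < 0" "a z < 0"
    using d d' d'(2)[of "- z"] a0 by (auto simp: z_def subset_iff dist_real_def)
  have a_neg: "a u < 0" if u: "u \<in> I" "u < 0" for u
  proof -
    have "0 < a z" if "0 < a u"
      using nonzero_on_interval_same_sign[OF is_interval_Int[OF I(2) is_interval_io[of 0]], of a u z]
        continuous_on_subset[OF cont_a] a_nz z u that by auto
    then show ?thesis using z(3) a_nz[OF u(1)] u(2) by force
  qed
  have "signed_speed f u = a u"
    using c'[OF u] norm_e[OF u] a0 a_pos[OF u] a_neg[OF u] unfolding signed_speed_def
    by (cases u "0::real" rule: linorder_cases) auto
  then show "signed_speed f u = vderiv (sing_image f) u \<bullet> e u"
    "vderiv (sing_image f) u = signed_speed f u *\<^sub>R e u"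
    using c'[OF u] unfolding a_def[symmetric] by simp_all
qed

text \<open>The orthogonality of \<open>e\<close> and \<open>n\<close> comes from the frontal
  condition, and the regularity of the invariants from writing them as inner products of
  \<open>vderiv e\<close> and \<open>vderiv b\<close> with frame vectors.\<close>

lemma framed_curve_darboux:
  assumes frontal: "frontal_with_normal U f \<nu>"
    and second_kind: "second_kind_singular U f \<nu> 0"
    and coords: "adapted_coordinates U I f \<nu>"
    and tangent: "darboux_tangent I f e"
    and n_def: "n = darboux_normal \<nu>"
    and b_def: "b = darboux_conormal \<nu> e"
    and invariants: "frame_invariants I e b n \<kappa>g \<kappa>\<nu> \<kappa>t"
  shows "framed_curve I (sing_image f) e b n (signed_speed f) \<kappa>g \<kappa>\<nu> \<kappa>t"
proof -
  have I: "open I" "is_interval I" "0 \<in> I" and axis: "\<And>u. u \<in> I \<Longrightarrow> u_axis u \<in> U"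
    using coords by (auto simp: adapted_coordinates_def)
  have smooth_f: "smooth_on U f" and smooth_\<nu>: "smooth_on U \<nu>"
    and norm_\<nu>: "\<And>p. p \<in> U \<Longrightarrow> norm (\<nu> p) = 1"
    and normal: "\<And>p X. p \<in> U \<Longrightarrow> frechet_derivative f (at p) X \<bullet> \<nu> p = 0"
    using frontal by (auto simp: frontal_with_normal_def)
  have smooth_e: "smooth_on I e" and norm_e: "\<And>u. u \<in> I \<Longrightarrow> norm (e u) = 1"
    and span_e: "\<And>u. u \<in> I \<Longrightarrow> u \<noteq> 0 \<Longrightarrow> e u \<in> span {vderiv (sing_image f) u}"
    using tangent by (auto simp: darboux_tangent_def)
  have bb: "bounded_bilinear cross3" using bilinear_cross bilinear_conv_bounded_bilinear by blast
  note Te = smooth_on_imp_times_vderiv_on[OF smooth_e]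
  have Tn: "times_vderiv_on k I n" for k
    unfolding n_def darboux_normal_def[abs_def] by (rule smooth_on_u_axis[OF smooth_\<nu> axis])
  have Tc: "times_vderiv_on k I (sing_image f)" for k
    unfolding sing_image_def[abs_def] by (rule smooth_on_u_axis[OF smooth_f axis])
  have b_eq: "b u = - cross3 (e u) (n u)" for u
    by (simp add: b_def n_def darboux_conormal_def)
  have Tb: "times_vderiv_on k I b" for k
    unfolding b_eq[abs_def]
    by (intro times_vderiv_on_linear[OF bounded_linear_minus[OF bounded_linear_ident]]
        times_vderiv_on_bilinear[OF bb] Te Tn)
  have en0: "e u \<bullet> n u = 0" if u: "u \<in> I" "u \<noteq> 0" for u
  proof -
    have "f differentiable at (u_axis u)"
      using smooth_f axis[OF u(1)] unfolding smooth_on_def by (metis k_times_cont_diff_on.simps(2))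
    then have "vderiv (sing_image f) u \<bullet> n u = 0"
      using normal axis[OF u(1)] by (simp add: vector_derivative_at[OF vderiv_sing_image] n_def darboux_normal_def)
    then show ?thesis using span_e[OF u] by (auto simp: span_singleton)
  qed
  \<comment> \<open>The tangency condition excludes 0, so orthogonality there follows by
    continuity.\<close>
  have en: "e u \<bullet> n u = 0" if u: "u \<in> I" for u
  proof (cases "u = 0")
    case True
    have "isCont e 0" "isCont n 0"
      using times_vderiv_on_has_vderiv[OF Te I(3)] times_vderiv_on_has_vderiv[OF Tn I(3)]
        has_vector_derivative_continuous by blast+
    then have "((\<lambda>u. e u \<bullet> n u) \<longlongrightarrow> e 0 \<bullet> n 0) (at 0)"
      by (intro tendsto_inner) (auto simp: isCont_def)
    moreover have "\<forall>\<^sub>F u in at 0. e u \<bullet> n u = 0"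
      using en0 I unfolding eventually_at_topological by blast
    ultimately have "((\<lambda>u::real. 0) \<longlongrightarrow> e 0 \<bullet> n 0) (at 0)" by (rule Lim_transform_eventually)
    then show ?thesis using True by (simp add: tendsto_const_iff)
  qed (use en0 u in auto)
  have norm_n: "norm (n u) = 1" if "u \<in> I" for u
    using norm_\<nu> axis[OF that] by (simp add: n_def darboux_normal_def)
  have norm_b: "norm (b u) = 1" if "u \<in> I" for u
  proof -
    \<comment> \<open>Lagrange's identity for the cross product of two orthonormal vectors.\<close>
    have "(norm (b u))\<^sup>2 = 1"
      using norm_cross_dot[of "e u" "n u"] en[OF that] norm_e[OF that] norm_n[OF that] by (simp add: b_eq)
    then show ?thesis by (simp add: power2_eq_1_iff) (smt (verit) norm_ge_zero)
  qed
  have eb: "e u \<bullet> b u = 0" "b u \<bullet> n u = 0" for u by (simp_all add: b_eq dot_cross_self)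
  have D: "(e has_vector_derivative (\<kappa>g u *\<^sub>R b u + \<kappa>\<nu> u *\<^sub>R n u)) (at u)"
    "(b has_vector_derivative (- \<kappa>g u *\<^sub>R e u + \<kappa>t u *\<^sub>R n u)) (at u)" if "u \<in> I" for u
    using invariants that by (auto simp: frame_invariants_def)
  have "vderiv e u \<bullet> b u = \<kappa>g u" "vderiv e u \<bullet> n u = \<kappa>\<nu> u" "vderiv b u \<bullet> n u = \<kappa>t u" if u: "u \<in> I" for u
    using norm_b[OF u] norm_n[OF u] eb[of u] en[OF u]
    by (simp_all add: vector_derivative_at[OF D(1)[OF u]] vector_derivative_at[OF D(2)[OF u]]
        inner_simps inner_commute norm_eq_1)
  moreover have "times_vderiv_on k I (\<lambda>u. vderiv e u \<bullet> b u)"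
    "times_vderiv_on k I (\<lambda>u. vderiv e u \<bullet> n u)" "times_vderiv_on k I (\<lambda>u. vderiv b u \<bullet> n u)" for k
    by (intro times_vderiv_on_bilinear[OF bounded_bilinear_inner] times_vderiv_on_vderiv[OF I(1)] Te Tb Tn)+
  ultimately have \<kappa>: "times_vderiv_on k I \<kappa>g" "times_vderiv_on k I \<kappa>\<nu>" "times_vderiv_on k I \<kappa>t" for k
    using times_vderiv_on_cong[OF I(1), of "\<lambda>u. vderiv e u \<bullet> b u" \<kappa>g]
      times_vderiv_on_cong[OF I(1), of "\<lambda>u. vderiv e u \<bullet> n u" \<kappa>\<nu>]
      times_vderiv_on_cong[OF I(1), of "\<lambda>u. vderiv b u \<bullet> n u" \<kappa>t] by simp_all
  note speed = signed_speed_eq[OF frontal second_kind coords tangent]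
  have eps: "times_vderiv_on k I (signed_speed f)" for k
    by (rule times_vderiv_on_cong[OF I(1) speed(1)[symmetric]], assumption)
       (intro times_vderiv_on_bilinear[OF bounded_bilinear_inner] times_vderiv_on_vderiv[OF I(1)] Te Tc)
  show ?thesis
  proof
    show "(sing_image f has_vector_derivative signed_speed f u *\<^sub>R e u) (at u)" if "u \<in> I" for u
      using times_vderiv_on_has_vderiv[OF Tc that] speed(2)[OF that] by metis
  qed (use I norm_e norm_b norm_n eb en invariants eps \<kappa> in auto)
qed

text \<open>The singular set is the image of \<open>I\<close> under the injective map
  \<open>u_axis\<close>, so the set equality leaves out no parameter.\<close>

lemma contour_edge_iff:
  assumes "adapted_coordinates U I f \<nu>"
  shows "contour_edge U I f w p \<longleftrightarrow> (\<forall>u\<in>I. (sing_image f u - p) \<bullet> w u = 0)"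
proof -
  have "singular_set U f = u_axis ` I" using assms by (auto simp: adapted_coordinates_def)
  then show ?thesis
    by (auto simp: contour_edge_def sing_image_def image_iff set_eq_iff inj_u_axis) (metis inj_u_axis)
qed

section \<open>Exchange of \<open>b\<close> and \<open>n\<close>: the normal developable\<close>

context framed_curve
begin

text \<open>Exchanging \<open>b\<close> and \<open>n\<close> turns \<open>(\<kappa>g, \<kappa>\<nu>, \<kappa>t)\<close> into \<open>(\<kappa>\<nu>, \<kappa>g, - \<kappa>t)\<close> and the osculating developable
  into the normal one, with reversed rulings.\<close>

lemma delta_swap: "u \<in> I \<Longrightarrow> delta_o \<kappa>\<nu> \<kappa>g (\<lambda>u. - \<kappa>t u) u = delta_n \<kappa>g \<kappa>\<nu> \<kappa>t u"
  using DERIV_imp_deriv[OF DERIV_minus[OF invariant_deriv(4)]]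
  by (simp add: delta_o_def delta_n_def)

lemma sigma_swap:
  assumes "u \<in> I"
  shows "sigma_o \<epsilon> \<kappa>\<nu> \<kappa>g (\<lambda>u. - \<kappa>t u) u = sigma_n \<epsilon> \<kappa>g \<kappa>\<nu> \<kappa>t u"
proof -
  \<comment> \<open>The two functions agree only on \<open>I\<close>; since \<open>I\<close> is
    open, they agree near \<open>u\<close>, which suffices for equal derivatives.\<close>
  have "deriv (delta_o \<kappa>\<nu> \<kappa>g (\<lambda>u. - \<kappa>t u)) u = deriv (delta_n \<kappa>g \<kappa>\<nu> \<kappa>t) u"
    using delta_swap open_I assms by (intro deriv_cong_ev) (auto simp: eventually_nhds)
  then show ?thesis
    using assms by (simp add: sigma_o_def sigma_n_def delta_swap algebra_simps)
qed

lemma direction_swap: "osc_direction e n \<kappa>g (\<lambda>u. - \<kappa>t u) u = - normal_direction e n \<kappa>g \<kappa>t u"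
  by (simp add: osc_direction_def normal_direction_def scaleR_right_distrib scaleR_right_diff_distrib)

text \<open>The reversed direction cancels the minus sign in \<open>striction_param_o\<close>, so
  the striction points coincide.\<close>

lemma striction_swap:
  assumes "u \<in> I"
  shows "ruled_surface c (osc_direction e n \<kappa>g (\<lambda>u. - \<kappa>t u)) u
      (striction_param_o \<epsilon> \<kappa>\<nu> \<kappa>g (\<lambda>u. - \<kappa>t u) u) =
    ruled_surface c (normal_direction e n \<kappa>g \<kappa>t) u (striction_param_n \<epsilon> \<kappa>g \<kappa>\<nu> \<kappa>t u)"
  using assms
  by (simp add: ruled_surface_def direction_swap striction_param_o_def striction_param_n_def delta_swap)

lemma cone_swap:
  "is_cone I (ruled_surface c (osc_direction e n \<kappa>g (\<lambda>u. - \<kappa>t u))) \<longleftrightarrow>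
   is_cone I (ruled_surface c (normal_direction e n \<kappa>g \<kappa>t))"
proof -
  have "range (ruled_surface c (osc_direction e n \<kappa>g (\<lambda>u. - \<kappa>t u)) u) =
    range (ruled_surface c (normal_direction e n \<kappa>g \<kappa>t) u)" for u
  proof -
    \<comment> \<open>Reversing the direction only reparametrizes each line by
      \<open>uminus\<close>, which preserves its range.\<close>
    have "ruled_surface c (osc_direction e n \<kappa>g (\<lambda>u. - \<kappa>t u)) u =
        ruled_surface c (normal_direction e n \<kappa>g \<kappa>t) u \<circ> uminus"
      by (auto simp: ruled_surface_def direction_swap)
    then show ?thesis by (metis surj_uminus image_comp)
  qed
  then show ?thesis by (simp add: is_cone_def)
qed

lemma normal_developable:
  assumes "\<forall>u\<in>I. (\<kappa>t u)\<^sup>2 + (\<kappa>g u)\<^sup>2 \<noteq> 0 \<and> delta_n \<kappa>g \<kappa>\<nu> \<kappa>t u \<noteq> 0"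
  defines "ND \<equiv> ruled_surface c (normal_direction e n \<kappa>g \<kappa>t)"
  shows "is_cone I ND \<longleftrightarrow> (\<exists>p. \<forall>u\<in>I. (c u - p) \<bullet> b u = 0)"
    and "is_cone I ND \<longleftrightarrow> (\<lambda>u. ND u (striction_param_n \<epsilon> \<kappa>g \<kappa>\<nu> \<kappa>t u)) constant_on I"
    and "is_cone I ND \<longleftrightarrow> (\<forall>u\<in>I. sigma_n \<epsilon> \<kappa>g \<kappa>\<nu> \<kappa>t u = 0)"
proof -
  interpret swapped: framed_curve I c e n b \<epsilon> \<kappa>\<nu> \<kappa>g "\<lambda>u. - \<kappa>t u" by (rule swap)
  have *: "\<forall>u\<in>I. (- \<kappa>t u)\<^sup>2 + (\<kappa>g u)\<^sup>2 \<noteq> 0 \<and> delta_o \<kappa>\<nu> \<kappa>g (\<lambda>u. - \<kappa>t u) u \<noteq> 0"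
    using assms by (simp add: delta_swap)
  show "is_cone I ND \<longleftrightarrow> (\<exists>p. \<forall>u\<in>I. (c u - p) \<bullet> b u = 0)"
    using swapped.cone_iff_contour(1)[OF *] unfolding ND_def cone_swap .
  show 2: "is_cone I ND \<longleftrightarrow> (\<lambda>u. ND u (striction_param_n \<epsilon> \<kappa>g \<kappa>\<nu> \<kappa>t u)) constant_on I"
    using swapped.cone_iff_contour(2)[OF *] unfolding ND_def cone_swap
    by (simp add: constant_on_def striction_swap)
  show "is_cone I ND \<longleftrightarrow> (\<forall>u\<in>I. sigma_n \<epsilon> \<kappa>g \<kappa>\<nu> \<kappa>t u = 0)"
    using swapped.striction_constant_iff[OF *] 2 unfolding ND_def
    by (simp add: constant_on_def striction_swap sigma_swap)
qed

end

theorem theorem4p2: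
  fixes U :: "(real^2) set" and I :: "real set"
    and f \<nu> :: "real^2 \<Rightarrow> real^3"
    and e b n :: "real \<Rightarrow> real^3"
    and \<kappa>g \<kappa>\<nu> \<kappa>t \<epsilon> :: "real \<Rightarrow> real"
    and OD ND :: "real \<Rightarrow> real \<Rightarrow> real^3"
    and s_o s_n :: "real \<Rightarrow> real^3"
  assumes frontal: "frontal_with_normal U f \<nu>"
    and second_kind: "second_kind_singular U f \<nu> 0"
    and coords: "adapted_coordinates U I f \<nu>"
    and e_tangent: "darboux_tangent I f e"
    and n_def: "n = darboux_normal \<nu>"
    and b_def: "b = darboux_conormal \<nu> e"
    and invariants: "frame_invariants I e b n \<kappa>g \<kappa>\<nu> \<kappa>t"
    and eps_def: "\<epsilon> = signed_speed f"
    and OD_def: "OD = ruled_surface (sing_image f) (osc_direction e b \<kappa>\<nu> \<kappa>t)"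
    and ND_def: "ND = ruled_surface (sing_image f) (normal_direction e n \<kappa>g \<kappa>t)"
    and s_o_def: "s_o = (\<lambda>u. OD u (striction_param_o \<epsilon> \<kappa>g \<kappa>\<nu> \<kappa>t u))"
    and s_n_def: "s_n = (\<lambda>u. ND u (striction_param_n \<epsilon> \<kappa>g \<kappa>\<nu> \<kappa>t u))"
  shows
    "((\<forall>u\<in>I. (\<kappa>t u)\<^sup>2 + (\<kappa>\<nu> u)\<^sup>2 \<noteq> 0 \<and> delta_o \<kappa>g \<kappa>\<nu> \<kappa>t u \<noteq> 0) \<longrightarrow>
        (is_cone I OD \<longleftrightarrow> (\<forall>u\<in>I. sigma_o \<epsilon> \<kappa>g \<kappa>\<nu> \<kappa>t u = 0)) \<and>
        (is_cone I OD \<longleftrightarrow> (\<exists>c. contour_edge U I f n c)) \<and>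
        (is_cone I OD \<longleftrightarrow> s_o constant_on I)) \<and>
     ((\<forall>u\<in>I. (\<kappa>t u)\<^sup>2 + (\<kappa>g u)\<^sup>2 \<noteq> 0 \<and> delta_n \<kappa>g \<kappa>\<nu> \<kappa>t u \<noteq> 0) \<longrightarrow>
        (is_cone I ND \<longleftrightarrow> (\<forall>u\<in>I. sigma_n \<epsilon> \<kappa>g \<kappa>\<nu> \<kappa>t u = 0)) \<and>
        (is_cone I ND \<longleftrightarrow> (\<exists>c. contour_edge U I f b c)) \<and>
        (is_cone I ND \<longleftrightarrow> s_n constant_on I))"
proof -
  interpret framed_curve I "sing_image f" e b n \<epsilon> \<kappa>g \<kappa>\<nu> \<kappa>t
    unfolding eps_def
    by (rule framed_curve_darboux[OF frontal second_kind coords e_tangent n_def b_def invariants])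
  show ?thesis
    using cone_iff_contour striction_constant_iff normal_developable
    unfolding contour_edge_iff[OF coords] OD_def ND_def s_o_def s_n_def by blast
qed

end
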